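(* Consider the quasi-variational inequality (QVI) of finding $(x^*,z^* )$ with $x^*\in K(x^* )$, $z^*\in F(x^* )$ and $\langle z^*,y-x^*\rangle\ge 0$ for all $y\in K(x^* )$, where $K(x)=K_g(x)\cap K_h$, and the Dantzig-Wolfe algorithm described in the context. Suppose that: (i) $F:\mathbb{R}^n\rightrightarrows\mathbb{R}^n$ is either single-valued and continuous, or set-valued and maximally monotone; (ii) the function $g$ has a continuous gradient $\nabla_y g(\cdot,\cdot)$ (the gradient with respect to its first argument, continuous as a function of both arguments); (iii) the subproblem operators $F^k$ are uniformly strongly monotone, i.e., there is $c>0$, independent of $k$, such that each $F^k$ is strongly monotone with modulus $c$; (iv) the sequence of matrices $\{Q^k\}$ is bounded; (v) the algorithm generates an infinite number of iterations, and the sequences $\{\mu^k\}$ and $\{y^{k+1}\}$ are bounded. Then $$\lim_{k\to\infty}\mathrm{gap}(y^{k+1})=0,\qquad \lim_{k\to\infty}\|y^{k+1}-x^k\|=0,$$ and every accumulation point $(\bar x,\bar\zeta)$ of the sequence $\{(x^k,\widehat\zeta^k)\}$ is a solution of the QVI, i.e., $\bar x\in K(\bar x)$, $\bar\zeta\in F(\bar x)$ and $\langle\bar\zeta,y-\bar x\rangle\ge 0$ for all $y\in K(\bar x)$.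
   Context: Notation. $\langle\cdot,\cdot\rangle$ and $\|\cdot\|$ are the Euclidean inner product and norm of $\mathbb{R}^n$. For a set-valued map $T:\mathbb{R}^n\rightrightarrows\mathbb{R}^n$, $\mathrm{dom}(T)=\{x:T(x)\ne\emptyset\}$. $T$ is strongly monotone with modulus $c>0$ if $\langle u-v,x-y\rangle\ge c\|x-y\|^2$ for all $x,y\in\mathrm{dom}(T)$, $u\in T(x)$, $v\in T(y)$; it is monotone if this holds with $c=0$; it is maximally monotone if it is monotone and its graph is not properly contained in the graph of another monotone map. For a convex set $D$ and $x\in D$, $\mathcal{N}_D(x)=\{u:\langle u,y-x\rangle\le 0\ \forall y\in D\}$. $\mathrm{Co}$ denotes convex hull and $\mathrm{int}$ the interior. Problem data. $F:\mathbb{R}^n\rightrightarrows\mathbb{R}^n$; $h:\mathbb{R}^n\to\mathbb{R}^l$ is (componentwise) convex; $g:\mathbb{R}^n\times\mathbb{R}^n\to\mathbb{R}^m$, $(y,x)\mapsto g(y,x)$, is such that $g(\cdot,x)$ is (componentwise) convex and differentiable for each $x$; $\nabla_y g_i$ is the gradient of $g_i$ with respect to its first argument. $K_g(x)=\{y: g(y,x)\le 0\}$, $K_h=\{y:h(y)\le 0\}$, $K(x)=K_g(x)\cap K_h$. It is assumed that $K_h\subset\mathrm{int}(\mathrm{dom}(F))$ and that a point $y^1\in K_g(y^1)\cap K_h$ is given. Algorithm. For $k=1,2,\dots$, with $Y^k=\{y^1,\dots,y^k\}$ and $K_h^k=\mathrm{Co}\,Y^k$: 1. Master QVI: find $x^k\in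 K_g(x^k)\cap K_h^k$ and $z_m^k\in F(x^k)$ with $\langle z_m^k,x-x^k\rangle\ge 0$ for all $x\in K_g(x^k)\cap K_h^k$, together with a Lagrange multiplier $\mu^k\in\mathbb{R}^m$ satisfying the KKT conditions $$0\in z_m^k+\sum_{i=1}^m\mu_i^k\nabla_y g_i(x^k,x^k)+\mathcal{N}_{K_h^k}(x^k),\quad \mu_i^k\ge 0,\ g_i(x^k,x^k)\le 0,\ \mu_i^k g_i(x^k,x^k)=0\ (i=1,\dots,m).$$ 2. VI subproblem: find $y^{k+1}\in K_h$ and $z_s^{k+1}\in F^k(y^{k+1})$ with $\langle z_s^{k+1},y-y^{k+1}\rangle\ge 0$ for all $y\in K_h$, where $$F^k(y)=\widehat F^k(y)+\Gamma^k(y)\mu^k+Q^k(y-x^k).$$ Here $Q^k$ is an $n\times n$ positive semidefinite matrix; $\Gamma^k(y)$ is the $n\times m$ matrix with columns $\Gamma^k_j(y)=\omega^k_j\nabla_y g_j(x^k,x^k)+(1-\omega_j^k)\nabla_y g_j(y,x^k)$ for some parameters $\omega^k_j\in[0,1]$ ($\omega^k_j=1$: "constant" option, $\omega^k_j=0$: "free" option); and $\widehat F^k$ is one of: $\widehat F^k(y)=\{z_m^k\}$ (constant); $\widehat F^k(y)=F(x^k)+\nabla F(x^k)(y-x^k)$ (first order, only allowed if $F$ is single-valued and $C^1$); $\widehat F^k(y)=F(y)$ (exact). 3. Compute $\mathrm{gap}(y^{k+1})$, where (at iteration $k$) $$\mathrm{gap}(y)=\langle\zeta^k,y-x^k\rangle,\qquad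 \zeta^k=z_m^k+\sum_{i=1}^m\mu_i^k\nabla_y g_i(x^k,x^k)\in F^k(x^k).$$ The algorithm continues with iteration $k+1$ if $\mathrm{gap}(y^{k+1})<0$, and stops otherwise. All master problems (including the existence of the multiplier $\mu^k$, which holds under a suitable constraint qualification) and all subproblems are assumed solvable. Finally, $$\widehat\zeta^k=z_s^{k+1}-\Gamma^k(y^{k+1})\mu^k-Q^k(y^{k+1}-x^k)\in\widehat F^k(y^{k+1}).$$
   Formalization: In (ii), g itself is also assumed jointly continuous in both arguments; continuity of the gradient ∇_y g alone does not control the dependence of g on x, and the claim x̄ ∈ K(x̄) then fails (e.g. g(y,x)=a(x) with a(0)=1, a=-1 elsewhere). *)

theory Defs
  imports "HOL-Analysis.Analysis"
begin

definition dom_of :: "('a \<Rightarrow> 'b set) \<Rightarrow> 'a set" where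
  "dom_of T = {x. T x \<noteq> {}}"

definition graph_of :: "('a \<Rightarrow> 'b set) \<Rightarrow> ('a \<times> 'b) set" where
  "graph_of T = {(x, u). u \<in> T x}"

definition monotone_with :: "real \<Rightarrow> ('a::real_inner \<Rightarrow> 'a set) \<Rightarrow> bool" where
  "monotone_with c T \<longleftrightarrow>
     (\<forall>x\<in>dom_of T. \<forall>y\<in>dom_of T. \<forall>u\<in>T x. \<forall>v\<in>T y. (u - v) \<bullet> (x - y) \<ge> c * (norm (x - y))\<^sup>2)"

definition strongly_monotone :: "real \<Rightarrow> ('a::real_inner \<Rightarrow> 'a set) \<Rightarrow> bool" where
  "strongly_monotone c T \<longleftrightarrow> c > 0 \<and> monotone_with c T"

definition monotone_map :: "('a::real_inner \<Rightarrow> 'a set) \<Rightarrow> bool" where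
  "monotone_map T \<longleftrightarrow> monotone_with 0 T"

definition maximally_monotone :: "('a::real_inner \<Rightarrow> 'a set) \<Rightarrow> bool" where
  "maximally_monotone T \<longleftrightarrow>
     monotone_map T \<and> (\<nexists>T'. monotone_map T' \<and> graph_of T \<subset> graph_of T')"

text \<open>A single-valued map need not be defined on the whole space: it has exactly one value at
  each point of its domain. Its selection is meaningful on the domain only.\<close>

definition single_valued_map :: "('a \<Rightarrow> 'b set) \<Rightarrow> bool" where
  "single_valued_map T \<longleftrightarrow> (\<forall>x\<in>dom_of T. is_singleton (T x))"

definition selection :: "('a \<Rightarrow> 'b set) \<Rightarrow> 'a \<Rightarrow> 'b" where
  "selection T x = the_elem (T x)"

definition single_valued_continuous ::
    "('a::topological_space \<Rightarrow> 'b::topological_space set) \<Rightarrow> bool" where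
  "single_valued_continuous T \<longleftrightarrow> single_valued_map T \<and> continuous_on (dom_of T) (selection T)"

text \<open>The Jacobian is only meaningful at interior points of the domain, so continuous
  differentiability is required there.\<close>

definition single_valued_C1 :: "(real^'n \<Rightarrow> (real^'n) set) \<Rightarrow> bool" where
  "single_valued_C1 T \<longleftrightarrow>
     single_valued_map T \<and>
     (\<forall>x\<in>interior (dom_of T). selection T differentiable (at x)) \<and>
     continuous_on (interior (dom_of T)) (\<lambda>x. jacobian (selection T) (at x))"

definition grad :: "('a::real_inner \<Rightarrow> real) \<Rightarrow> 'a \<Rightarrow> 'a" where
  "grad f x = (THE D. GDERIV f x :> D)"

text \<open>Only used at points \<^term>\<open>x \<in> D\<close>.\<close>

definition normal_cone :: "'a::real_inner set \<Rightarrow> 'a \<Rightarrow> 'a set" where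
  "normal_cone D x = {u. \<forall>y\<in>D. u \<bullet> (y - x) \<le> 0}"

text \<open>Symmetry is not part of positive semidefiniteness here.\<close>

definition pos_semidef :: "real^'n^'n \<Rightarrow> bool" where
  "pos_semidef A \<longleftrightarrow> (\<forall>v. v \<bullet> (A *v v) \<ge> 0)"

definition accumulation_point :: "(nat \<Rightarrow> 'a::topological_space) \<Rightarrow> 'a \<Rightarrow> bool" where
  "accumulation_point s l \<longleftrightarrow> (\<exists>r. strict_mono r \<and> (s \<circ> r) \<longlonglongrightarrow> l)"

definition solves_QVI ::
    "('a::real_inner \<Rightarrow> 'a set) \<Rightarrow> ('a \<Rightarrow> 'a set) \<Rightarrow> 'a \<Rightarrow> 'a \<Rightarrow> bool" where
  "solves_QVI T K x z \<longleftrightarrow> x \<in> K x \<and> z \<in> T x \<and> (\<forall>y\<in>K x. z \<bullet> (y - x) \<ge> 0)"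

definition solves_VI ::
    "('a::real_inner \<Rightarrow> 'a set) \<Rightarrow> 'a set \<Rightarrow> 'a \<Rightarrow> 'a \<Rightarrow> bool" where
  "solves_VI T C x z \<longleftrightarrow> x \<in> C \<and> z \<in> T x \<and> (\<forall>y\<in>C. z \<bullet> (y - x) \<ge> 0)"

text \<open>The order on \<^typ>\<open>real^'m\<close> is the componentwise one.\<close>

definition K_g :: "('a \<Rightarrow> 'a \<Rightarrow> real^'m) \<Rightarrow> 'a \<Rightarrow> 'a set" where
  "K_g g x = {y. g y x \<le> 0}"

definition K_h :: "('a \<Rightarrow> real^'l) \<Rightarrow> 'a set" where
  "K_h h = {y. h y \<le> 0}"

definition grad_y :: "(real^'n \<Rightarrow> real^'n \<Rightarrow> real^'m) \<Rightarrow> 'm \<Rightarrow> real^'n \<Rightarrow> real^'n \<Rightarrow> real^'n" where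
  "grad_y g i y x = grad (\<lambda>v. g v x $ i) y"

definition zeta ::
    "(real^'n \<Rightarrow> real^'n \<Rightarrow> real^'m) \<Rightarrow> real^'n \<Rightarrow> real^'n \<Rightarrow> real^'m \<Rightarrow> real^'n" where
  "zeta g x z \<mu> = z + (\<Sum>i\<in>UNIV. \<mu> $ i *\<^sub>R grad_y g i x x)"

definition master_KKT ::
    "(real^'n \<Rightarrow> real^'n \<Rightarrow> real^'m) \<Rightarrow> (real^'n) set \<Rightarrow> real^'n \<Rightarrow> real^'n \<Rightarrow> real^'m \<Rightarrow> bool" where
  "master_KKT g C x z \<mu> \<longleftrightarrow>
     0 \<in> (\<lambda>v. zeta g x z \<mu> + v) ` normal_cone C x \<and>
     (\<forall>i. \<mu> $ i \<ge> 0 \<and> g x x $ i \<le> 0 \<and> \<mu> $ i * g x x $ i = 0)"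

definition gap ::
    "(real^'n \<Rightarrow> real^'n \<Rightarrow> real^'m) \<Rightarrow> real^'n \<Rightarrow> real^'n \<Rightarrow> real^'m \<Rightarrow> real^'n \<Rightarrow> real" where
  "gap g x z \<mu> y = zeta g x z \<mu> \<bullet> (y - x)"

definition Gamma ::
    "(real^'n \<Rightarrow> real^'n \<Rightarrow> real^'m) \<Rightarrow> real^'m \<Rightarrow> real^'n \<Rightarrow> real^'n \<Rightarrow> real^'m^'n" where
  "Gamma g \<omega> x y =
     (\<chi> i j. (\<omega> $ j *\<^sub>R grad_y g j x x + (1 - \<omega> $ j) *\<^sub>R grad_y g j y x) $ i)"

datatype approx = Constant | First_Order | Exact

definition F_hat ::
    "(real^'n \<Rightarrow> (real^'n) set) \<Rightarrow> approx \<Rightarrow> real^'n \<Rightarrow> real^'n \<Rightarrow> real^'n \<Rightarrow> (real^'n) set" where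
  "F_hat F a x z y =
     (case a of
        Constant \<Rightarrow> {z}
      | First_Order \<Rightarrow> (\<lambda>u. u + jacobian (selection F) (at x) *v (y - x)) ` F x
      | Exact \<Rightarrow> F y)"

definition F_sub ::
    "(real^'n \<Rightarrow> (real^'n) set) \<Rightarrow> (real^'n \<Rightarrow> real^'n \<Rightarrow> real^'m) \<Rightarrow> approx \<Rightarrow> real^'m \<Rightarrow>
     real^'n^'n \<Rightarrow> real^'n \<Rightarrow> real^'n \<Rightarrow> real^'m \<Rightarrow> real^'n \<Rightarrow> (real^'n) set" where
  "F_sub F g a \<omega> Q x z \<mu> y =
     (\<lambda>u. u + Gamma g \<omega> x y *v \<mu> + Q *v (y - x)) ` F_hat F a x z y"

definition zeta_hat ::
    "(real^'n \<Rightarrow> real^'n \<Rightarrow> real^'m) \<Rightarrow> real^'m \<Rightarrow> real^'n^'n \<Rightarrow> real^'n \<Rightarrow> real^'m \<Rightarrow>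
     real^'n \<Rightarrow> real^'n \<Rightarrow> real^'n" where
  "zeta_hat g \<omega> Q x \<mu> y z\<^sub>s = z\<^sub>s - Gamma g \<omega> x y *v \<mu> - Q *v (y - x)"

end

theory Submission
  imports Defs
begin

text \<open>
  Write \<open>\<zeta> k\<close> for the vector that defines the gap at iteration \<open>k\<close>, and call \<open>y (k + 1) - x k\<close> the
  step. Three observations carry the proof.

  First, the gap tends to zero. By the optimality conditions of the master problem, \<open>\<zeta> k\<close> is
  nonnegative on \<open>y j - x k\<close> for every earlier point \<open>y j\<close>, while it is negative on the step. Each
  iteration thus cuts off its new point, and if the cuts are bounded and stay deep,
  the points so produced are uniformly separated, which a bounded sequence does not allow
  (\<open>cutting_plane_gap_tendsto_0\<close>). The cuts are bounded since all \<open>x k\<close> lie in a compact subset of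
  the interior of the domain of \<open>F\<close>, on which \<open>F\<close> is bounded: by continuity if \<open>F\<close> is single-valued,
  and because monotone maps are locally bounded at interior points of their domain otherwise
  (\<open>monotone_map_bounded_on_compact\<close>).

  Second, the gap dominates the step. Since \<open>\<zeta> k\<close> is a value at \<open>x k\<close> of the strongly monotone
  subproblem operator, the gap is at most \<open>- c\<close> times the squared length of the step
  (\<open>gap_le_minus_dist_square\<close>). So the steps tend to zero.

  Third, as the steps vanish, all approximations become exact. The approximate values of \<open>F\<close> differ
  from true values of \<open>F\<close> by a null sequence (\<open>F_hat_near_value\<close>), and \<open>F\<close> has a
  closed graph on the relevant set, so the limit of the values is a value at the limit point.
  Choosing a further subsequence along which the multipliers converge, the subproblem
  inequalities turn into a variational inequality over \<open>K_h h\<close> for the Lagrangian at the limit.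
  Complementarity and convexity of \<open>g\<close> in its first argument remove the multipliers
  (\<open>multiplier_elimination\<close>), which leaves the quasi-variational inequality.
\<close>

section \<open>Cutting planes force the gap to vanish\<close>

lemma bounded_sequence_not_separated:
  fixes p :: "nat \<Rightarrow> 'a::heine_borel"
  assumes "bounded (range p)" and "d > 0"
  obtains i j where "i < j" and "dist (p i) (p j) < d"
proof -
  obtain l r where r: "strict_mono r" and "(p \<circ> r) \<longlonglongrightarrow> l"
    using bounded_imp_convergent_subsequence[OF assms(1)] by blast
  then have "Cauchy (p \<circ> r)"
    by (blast intro: LIMSEQ_imp_Cauchy)
  then obtain M where "\<forall>m\<ge>M. \<forall>n\<ge>M. dist ((p \<circ> r) m) ((p \<circ> r) n) < d"
    using \<open>d > 0\<close> unfolding Cauchy_def by blast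
  then have "dist (p (r M)) (p (r (Suc M))) < d" by simp
  moreover have "r M < r (Suc M)" using r by (simp add: strict_mono_def)
  ultimately show ?thesis using that by blast
qed

text \<open>If the values stayed below \<open>-e\<close> infinitely often, then for two such iterations \<open>k < k'\<close> the
  vector \<open>\<zeta> k'\<close> would separate the old point \<open>y (k + 1)\<close>, which the cut at \<open>k'\<close> already respects,
  from the new point \<open>y (k' + 1)\<close>, which it violates by \<open>e\<close>. As \<open>norm (\<zeta> k') \<le> B\<close>, the two points are
  at distance at least \<open>e / B\<close>. Infinitely many points of a bounded set cannot be that far apart
  from each other.\<close>

lemma cutting_plane_gap_tendsto_0:
  fixes \<zeta> x y :: "nat \<Rightarrow> 'a::euclidean_space"
  assumes "bounded (\<zeta> ` {1..})" and "bounded ((\<lambda>k. y (k + 1)) ` {1..})"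
    and cut: "\<And>j k. 1 \<le> j \<Longrightarrow> j \<le> k \<Longrightarrow> \<zeta> k \<bullet> (y j - x k) \<ge> 0"
    and neg: "\<And>k. k \<ge> 1 \<Longrightarrow> \<zeta> k \<bullet> (y (k + 1) - x k) \<le> 0"
  shows "(\<lambda>k. \<zeta> k \<bullet> (y (k + 1) - x k)) \<longlonglongrightarrow> 0"
proof (rule ccontr)
  assume "\<not> ?thesis"
  then obtain e where "e > 0"
    and frequent: "\<And>N. \<exists>k\<ge>N. e \<le> \<bar>\<zeta> k \<bullet> (y (k + 1) - x k)\<bar>"
    unfolding LIMSEQ_iff by (force simp: not_less)
  define S where "S = {k. k \<ge> 1 \<and> e \<le> - (\<zeta> k \<bullet> (y (k + 1) - x k))}"
  have "\<exists>k\<ge>N. k \<in> S" for N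
    using frequent[of "max 1 N"] neg unfolding S_def by fastforce
  then have "infinite S"
    by (meson finite_nat_set_iff_bounded_le infinite_nat_iff_unbounded_le)
  then obtain r :: "nat \<Rightarrow> nat" where r: "strict_mono r" and rS: "\<And>i. r i \<in> S"
    using infinite_enumerate by blast
  obtain B where B: "B > 0" "\<And>k. k \<ge> 1 \<Longrightarrow> norm (\<zeta> k) \<le> B"
    using assms(1) unfolding bounded_pos by auto
  have "bounded (range (\<lambda>i. y (r i + 1)))"
    using assms(2) by (rule bounded_subset) (use rS S_def in auto)
  then obtain i j where "i < j" and close: "dist (y (r i + 1)) (y (r j + 1)) < e / B"
    using bounded_sequence_not_separated \<open>e > 0\<close> \<open>B > 0\<close> by (metis divide_pos_pos)
  have lt: "r i + 1 \<le> r j" using r \<open>i < j\<close> by (simp add: Suc_leI strict_mono_less)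
  have rj: "r j \<ge> 1" "e \<le> - (\<zeta> (r j) \<bullet> (y (r j + 1) - x (r j)))"
    using rS[of j] by (auto simp: S_def)
  \<comment> \<open>The iterate \<open>y (r i + 1)\<close> is already in the master set at iteration \<open>r j\<close>.\<close>
  have "e \<le> \<zeta> (r j) \<bullet> (y (r i + 1) - y (r j + 1))"
    using cut[OF _ lt] rj(2) by (simp add: inner_diff_right)
  also have "\<dots> \<le> norm (\<zeta> (r j)) * dist (y (r i + 1)) (y (r j + 1))"
    by (simp add: dist_norm norm_cauchy_schwarz)
  also have "\<dots> \<le> B * dist (y (r i + 1)) (y (r j + 1))"
    using B rj(1) by (simp add: mult_right_mono)
  also have "\<dots> < B * (e / B)"
    using close \<open>B > 0\<close> by (rule mult_strict_left_mono)
  finally show False using \<open>B > 0\<close> by simp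
qed

lemma tendsto_0_if_square_le:
  fixes u d :: "nat \<Rightarrow> real"
  assumes "u \<longlonglongrightarrow> 0" and "c > 0" and le: "\<And>k. k \<ge> 1 \<Longrightarrow> u k \<le> - c * (d k)\<^sup>2"
  shows "d \<longlonglongrightarrow> 0"
proof -
  have "(\<lambda>k. u k / - c) \<longlonglongrightarrow> 0 / - c"
    using assms(1,2) by (intro tendsto_divide tendsto_const) auto
  then have "(\<lambda>k. u k / - c) \<longlonglongrightarrow> 0" by (simp only: div_0)
  moreover have "norm ((d k)\<^sup>2) \<le> u k / - c" if "k \<ge> 1" for k
    using le[OF that] \<open>c > 0\<close> by (simp add: field_simps)
  then have "\<forall>\<^sub>F k in sequentially. norm ((d k)\<^sup>2) \<le> u k / - c"
    by (rule eventually_sequentiallyI)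
  ultimately have "(\<lambda>k. (d k)\<^sup>2) \<longlonglongrightarrow> 0"
    by (metis Lim_null_comparison)
  from tendsto_real_sqrt[OF this] have "(\<lambda>k. \<bar>d k\<bar>) \<longlonglongrightarrow> 0"
    by (simp only: real_sqrt_abs real_sqrt_zero)
  then show ?thesis by (rule tendsto_rabs_zero_cancel)
qed

section \<open>Bounded values and closed graphs\<close>

lemma monotone_withD:
  assumes "monotone_with c T" and "u \<in> T x" and "v \<in> T y"
  shows "(u - v) \<bullet> (x - y) \<ge> c * (norm (x - y))\<^sup>2"
  using assms unfolding monotone_with_def dom_of_def by blast

text \<open>Values at the finitely many points \<open>x0 \<plusminus> e *\<^sub>R b\<close> control all nearby values: monotonicity
  against the value \<open>u v\<close> at such a point \<open>v\<close> bounds \<open>z \<bullet> (v - x)\<close> from above, hence bounds each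
  coordinate of \<open>z\<close> by a constant plus \<open>norm z * d / e\<close>. Summing over the coordinates, the last term
  is absorbed if the ball is small enough.\<close>

lemma monotone_map_locally_bounded:
  fixes T :: "'a::euclidean_space \<Rightarrow> 'a set"
  assumes mono: "monotone_map T" and "x0 \<in> interior (dom_of T)"
  obtains d B where "d > 0" and "\<And>x z. x \<in> ball x0 d \<Longrightarrow> z \<in> T x \<Longrightarrow> norm z \<le> B"
proof -
  obtain e where "e > 0" and e: "cball x0 e \<subseteq> dom_of T"
    using assms(2) by (meson mem_interior_cball)
  define S where "S = {x0 + s *\<^sub>R (e *\<^sub>R b) | s b. s \<in> {-1, 1} \<and> b \<in> Basis}"
  have "S = (\<Union>s\<in>{-1, 1}. (\<lambda>b. x0 + s *\<^sub>R (e *\<^sub>R b)) ` Basis)"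
    unfolding S_def by blast
  then have "finite S" by simp
  have S_near: "norm (v - x0) = e" if "v \<in> S" for v
    using that \<open>e > 0\<close> unfolding S_def by auto
  then have "S \<subseteq> dom_of T"
    using e by (force simp: dist_norm norm_minus_commute)
  then have "\<forall>v\<in>S. \<exists>u. u \<in> T v"
    unfolding dom_of_def by blast
  then obtain u where u: "\<And>v. v \<in> S \<Longrightarrow> u v \<in> T v" by metis
  obtain U where U: "\<And>v. v \<in> S \<Longrightarrow> norm (u v) \<le> U"
    using finite_imp_bounded[of "u ` S"] \<open>finite S\<close> unfolding bounded_iff by auto
  define n where "n = real DIM('a)"
  have "n \<ge> 1" unfolding n_def by (simp add: DIM_positive Suc_leI)
  \<comment> \<open>With this radius the \<open>n\<close> error terms \<open>norm z * d\<close> add up to half of \<open>e * norm z\<close>.\<close>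
  define d where "d = e / (2 * n)"
  have "d > 0" "d \<le> e" using \<open>e > 0\<close> \<open>n \<ge> 1\<close> by (auto simp: d_def field_simps)
  have bound: "norm z \<le> 2 * n * (U * (2 * e)) / e" if x: "x \<in> ball x0 d" and z: "z \<in> T x" for x z
  proof -
    have dx: "norm (x0 - x) \<le> d" using x by (simp add: dist_norm)
    have vertex: "z \<bullet> (v - x0) \<le> U * (2 * e) + norm z * d" if "v \<in> S" for v
    proof -
      have "(z - u v) \<bullet> (x - v) \<ge> 0"
        using monotone_withD[OF mono[unfolded monotone_map_def] z u[OF that]] by simp
      then have "z \<bullet> (v - x0) \<le> u v \<bullet> (v - x) + z \<bullet> (x - x0)"
        by (simp add: inner_diff)
      also have "\<dots> \<le> norm (u v) * norm (v - x) + norm z * norm (x - x0)"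
        by (intro add_mono norm_cauchy_schwarz)
      also have "\<dots> \<le> U * (2 * e) + norm z * d"
      proof (intro add_mono mult_mono)
        show "norm (v - x) \<le> 2 * e"
          using S_near[OF that] dx \<open>d \<le> e\<close> norm_triangle_ineq[of "v - x0" "x0 - x"] by simp
        show "norm (x - x0) \<le> d" using dx by (simp add: norm_minus_commute)
        show "0 \<le> U" using U[OF that] norm_ge_zero order_trans by blast
      qed (use U[OF that] in auto)
      finally show ?thesis .
    qed
    have "e * \<bar>z \<bullet> b\<bar> \<le> U * (2 * e) + norm z * d" if "b \<in> Basis" for b
    proof -
      have "x0 + 1 *\<^sub>R (e *\<^sub>R b) \<in> S" "x0 + (-1) *\<^sub>R (e *\<^sub>R b) \<in> S"
        using that unfolding S_def by blast+
      then show ?thesis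
        using vertex \<open>e > 0\<close> by (fastforce simp: abs_if)
    qed
    then have "(\<Sum>b\<in>Basis. e * \<bar>z \<bullet> b\<bar>) \<le> n * (U * (2 * e) + norm z * d)"
      unfolding n_def by (rule sum_bounded_above)
    moreover have "e * norm z \<le> (\<Sum>b\<in>Basis. e * \<bar>z \<bullet> b\<bar>)"
      using norm_le_l1[of z] \<open>e > 0\<close> by (simp flip: sum_distrib_left)
    ultimately have "e * norm z \<le> n * (U * (2 * e)) + e * norm z / 2"
      using \<open>n \<ge> 1\<close> by (simp add: d_def distrib_left mult.commute)
    then show ?thesis using \<open>e > 0\<close> by (simp add: field_simps)
  qed
  show ?thesis using that[OF \<open>d > 0\<close> bound] .
qed

lemma monotone_map_bounded_on_compact:
  fixes T :: "'a::euclidean_space \<Rightarrow> 'a set"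
  assumes "monotone_map T" and "compact C" and "C \<subseteq> interior (dom_of T)"
  shows "bounded (\<Union>x\<in>C. T x)"
proof -
  have "\<exists>d B. d > 0 \<and> (\<forall>x\<in>ball x0 d. \<forall>z\<in>T x. norm z \<le> B)" if "x0 \<in> C" for x0
    using monotone_map_locally_bounded[OF assms(1)] assms(3) that by (metis subsetD)
  then obtain d B where d: "\<And>x0. x0 \<in> C \<Longrightarrow> d x0 > 0"
    and B: "\<And>x0 x z. x0 \<in> C \<Longrightarrow> x \<in> ball x0 (d x0) \<Longrightarrow> z \<in> T x \<Longrightarrow> norm z \<le> B x0"
    by metis
  obtain D where "D \<subseteq> C" "finite D" and D: "C \<subseteq> (\<Union>x0\<in>D. ball x0 (d x0))"
  proof (rule compactE_image[OF assms(2), of C "\<lambda>x0. ball x0 (d x0)"])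
    show "C \<subseteq> (\<Union>x0\<in>C. ball x0 (d x0))"
      using d by force
  qed auto
  have "bounded (\<Union>x0\<in>D. \<Union>x\<in>ball x0 (d x0). T x)"
  proof (rule bounded_UN[OF \<open>finite D\<close>], rule ballI)
    fix x0 assume "x0 \<in> D"
    then show "bounded (\<Union>x\<in>ball x0 (d x0). T x)"
      using B \<open>D \<subseteq> C\<close> unfolding bounded_iff by blast
  qed
  then show ?thesis by (rule bounded_subset) (use D in blast)
qed

lemma single_valued_eq_selection:
  assumes "single_valued_map T" and "z \<in> T x"
  shows "T x = {selection T x}" and "z = selection T x"
proof -
  have "is_singleton (T x)"
    using assms unfolding single_valued_map_def dom_of_def by blast
  then show "T x = {selection T x}"
    unfolding selection_def by (metis is_singleton_the_elem)
  then show "z = selection T x" using assms(2) by auto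
qed

lemma single_valued_continuous_bounded_on_compact:
  fixes T :: "'a::metric_space \<Rightarrow> 'b::metric_space set"
  assumes "single_valued_continuous T" and "compact C" and "C \<subseteq> dom_of T"
  shows "bounded (\<Union>x\<in>C. T x)"
proof -
  have sv: "single_valued_map T" and cont: "continuous_on (dom_of T) (selection T)"
    using assms(1) unfolding single_valued_continuous_def by auto
  have "compact (selection T ` C)"
    using compact_continuous_image[OF continuous_on_subset[OF cont assms(3)] assms(2)] .
  moreover have "(\<Union>x\<in>C. T x) \<subseteq> selection T ` C"
    using single_valued_eq_selection(2)[OF sv] by blast
  ultimately show ?thesis
    using bounded_subset compact_imp_bounded by blast
qed

text \<open>A limit of points of the graph is monotonically related to every point of the graph, so adding
  it keeps the map monotone; maximality says that it was there already.\<close>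

lemma maximally_monotone_closed_graph:
  fixes T :: "'a::real_inner \<Rightarrow> 'a set"
  assumes max: "maximally_monotone T"
    and mem: "\<And>k. w k \<in> T (p k)" and p: "p \<longlonglongrightarrow> x" and w: "w \<longlonglongrightarrow> z"
  shows "z \<in> T x"
proof (rule ccontr)
  assume "z \<notin> T x"
  have mono: "monotone_with 0 T"
    using max unfolding maximally_monotone_def monotone_map_def by blast
  have compat: "(z - v) \<bullet> (x - q) \<ge> 0" if "v \<in> T q" for v q
  proof (rule LIMSEQ_le_const)
    show "(\<lambda>k. (w k - v) \<bullet> (p k - q)) \<longlonglongrightarrow> (z - v) \<bullet> (x - q)"
      by (intro tendsto_intros p w)
    show "\<exists>N. \<forall>k\<ge>N. 0 \<le> (w k - v) \<bullet> (p k - q)"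
      using monotone_withD[OF mono mem that] by auto
  qed
  define T' where "T' = T(x := insert z (T x))"
  have T': "v \<in> T' q \<longleftrightarrow> v \<in> T q \<or> (q = x \<and> v = z)" for v q
    unfolding T'_def by auto
  have "(u - v) \<bullet> (p - q) \<ge> 0" if "u \<in> T' p" "v \<in> T' q" for u v p q
  proof -
    have "(v - u) \<bullet> (q - p) = (u - v) \<bullet> (p - q)"
      by (simp add: inner_diff)
    then show ?thesis
      using that monotone_withD[OF mono, of u p v q] compat[of u p] compat[of v q]
      unfolding T' by auto
  qed
  then have "monotone_map T'"
    unfolding monotone_map_def monotone_with_def by simp
  moreover have "graph_of T \<subset> graph_of T'"
    using \<open>z \<notin> T x\<close> T' unfolding graph_of_def by blast
  ultimately show False
    using max unfolding maximally_monotone_def by blast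
qed

lemma single_valued_continuous_closed_graph:
  fixes T :: "'a::metric_space \<Rightarrow> 'b::metric_space set"
  assumes svc: "single_valued_continuous T" and "x \<in> dom_of T"
    and mem: "\<And>k. w k \<in> T (p k)" and p: "p \<longlonglongrightarrow> x" and w: "w \<longlonglongrightarrow> z"
  shows "z \<in> T x"
proof -
  have sv: "single_valued_map T" and cont: "continuous_on (dom_of T) (selection T)"
    using svc unfolding single_valued_continuous_def by auto
  have "\<And>k. p k \<in> dom_of T" using mem unfolding dom_of_def by blast
  then have "(\<lambda>k. selection T (p k)) \<longlonglongrightarrow> selection T x"
    using continuous_on_tendsto_compose[OF cont p \<open>x \<in> dom_of T\<close>] by simp
  moreover have "w = (\<lambda>k. selection T (p k))"
    using single_valued_eq_selection(2)[OF sv mem] by blast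
  ultimately have "z = selection T x"
    using w LIMSEQ_unique by blast
  moreover obtain u where "u \<in> T x" using \<open>x \<in> dom_of T\<close> unfolding dom_of_def by blast
  ultimately show ?thesis using single_valued_eq_selection(2)[OF sv] by blast
qed

section \<open>Convex constraints\<close>

lemma differentiable_imp_GDERIV_grad:
  fixes f :: "'a::euclidean_space \<Rightarrow> real"
  assumes "f differentiable (at x)"
  shows "GDERIV f x :> grad f x"
proof -
  obtain f' where f': "(f has_derivative f') (at x)"
    using assms unfolding differentiable_def by blast
  define D where "D = (\<Sum>b\<in>Basis. f' b *\<^sub>R b)"
  have "f' v = v \<bullet> D" for v
  proof -
    have "f' v = f' (\<Sum>b\<in>Basis. (v \<bullet> b) *\<^sub>R b)" by (simp add: euclidean_representation)
    also have "\<dots> = (\<Sum>b\<in>Basis. (v \<bullet> b) * f' b)"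
      using has_derivative_linear[OF f'] by (simp add: linear_sum linear_cmul)
    also have "\<dots> = v \<bullet> D"
      unfolding D_def by (simp add: inner_sum_right mult.commute)
    finally show ?thesis .
  qed
  then have D: "GDERIV f x :> D"
    using f' unfolding gderiv_def by presburger
  have "E = D" if "GDERIV f x :> E" for E
  proof -
    have "(\<lambda>v. v \<bullet> E) = (\<lambda>v. v \<bullet> D)"
      using that D has_derivative_unique unfolding gderiv_def by blast
    then have "(E - D) \<bullet> E = (E - D) \<bullet> D" by metis
    then have "(E - D) \<bullet> (E - D) = 0" by (simp add: inner_diff_right)
    then show "E = D" by simp
  qed
  then show ?thesis
    using D unfolding grad_def by (metis theI)
qed

text \<open>Restricting to the line through \<open>x\<close> and \<open>y\<close> reduces this to the tangent inequality for convex
  functions of one real variable.\<close>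

lemma convex_gradient_inequality:
  fixes f :: "'a::real_inner \<Rightarrow> real"
  assumes conv: "convex_on UNIV f" and D: "GDERIV f x :> D"
  shows "D \<bullet> (y - x) \<le> f y - f x"
proof -
  define \<phi> where "\<phi> t = f (x + t *\<^sub>R (y - x))" for t
  have "convex_on UNIV \<phi>"
  proof (rule convex_onI)
    fix t a b :: real assume "0 < t" "t < 1"
    have "x + ((1 - t) *\<^sub>R a + t *\<^sub>R b) *\<^sub>R (y - x) =
        (1 - t) *\<^sub>R (x + a *\<^sub>R (y - x)) + t *\<^sub>R (x + b *\<^sub>R (y - x))"
      by (simp add: algebra_simps)
    then show "\<phi> ((1 - t) *\<^sub>R a + t *\<^sub>R b) \<le> (1 - t) * \<phi> a + t * \<phi> b"
      unfolding \<phi>_def using convex_onD[OF conv, of t] \<open>0 < t\<close> \<open>t < 1\<close> by simp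
  qed simp
  moreover have "(\<phi> has_field_derivative D \<bullet> (y - x)) (at 0)"
  proof -
    have "((\<lambda>t. x + t *\<^sub>R (y - x)) has_derivative (\<lambda>t. t *\<^sub>R (y - x))) (at 0)"
      by (auto intro!: derivative_eq_intros)
    moreover have "(f has_derivative (\<lambda>v. v \<bullet> D)) (at (x + 0 *\<^sub>R (y - x)))"
      using D unfolding gderiv_def by simp
    ultimately have "(\<phi> has_derivative (\<lambda>t. (t *\<^sub>R (y - x)) \<bullet> D)) (at 0)"
      unfolding \<phi>_def using has_derivative_compose by blast
    then show ?thesis
      unfolding has_field_derivative_def inner_scaleR_left inner_commute[of "y - x" D]
      by (simp only: mult_commute_abs)
  qed
  ultimately have "\<phi> 1 - \<phi> 0 \<ge> D \<bullet> (y - x) * (1 - 0)"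
    by (intro convex_on_imp_above_tangent[where A = UNIV]) auto
  then show ?thesis by (simp add: \<phi>_def)
qed

lemma convex_K_h:
  fixes h :: "'a::real_vector \<Rightarrow> real^'l"
  assumes "\<And>i. convex_on UNIV (\<lambda>v. h v $ i)"
  shows "convex (K_h h)"
proof -
  have "K_h h = (\<Inter>i. {v. h v $ i \<le> 0})"
    unfolding K_h_def less_eq_vec_def by auto
  moreover have "convex {v. h v $ i \<le> 0}" for i
  proof (rule convexI)
    fix u v and s t :: real
    assume uv: "u \<in> {v. h v $ i \<le> 0}" "v \<in> {v. h v $ i \<le> 0}"
      and st: "0 \<le> s" "0 \<le> t" "s + t = 1"
    have "h (s *\<^sub>R u + t *\<^sub>R v) $ i \<le> s * h u $ i + t * h v $ i"
      using assms[of i] st unfolding convex_on_def by blast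
    also have "\<dots> \<le> 0"
      using uv st by (simp add: add_nonpos_nonpos mult_nonneg_nonpos)
    finally show "s *\<^sub>R u + t *\<^sub>R v \<in> {v. h v $ i \<le> 0}" by simp
  qed
  ultimately show ?thesis by (simp add: convex_INT)
qed

lemma closed_K_h:
  fixes h :: "'a::euclidean_space \<Rightarrow> real^'l"
  assumes "\<And>i. convex_on UNIV (\<lambda>v. h v $ i)"
  shows "closed (K_h h)"
proof -
  have "K_h h = (\<Inter>i. {v. h v $ i \<le> 0})"
    unfolding K_h_def less_eq_vec_def by auto
  moreover have "closed {v. h v $ i \<le> 0}" for i
    using convex_on_continuous[OF open_UNIV assms] continuous_on_const
    by (rule closed_Collect_le)
  ultimately show ?thesis by (simp add: closed_INT)
qed

section \<open>The subproblem operators\<close>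

lemma bounded_bilinear_matrix_vector_mult:
  "bounded_bilinear ((*v) :: real^'n^'m \<Rightarrow> real^'n \<Rightarrow> real^'m)"
proof -
  have "bilinear ((*v) :: real^'n^'m \<Rightarrow> real^'n \<Rightarrow> real^'m)"
    unfolding bilinear_def
    by (auto intro!: linearI
        simp: matrix_vector_right_distrib matrix_vector_mult_add_rdistrib
          scaleR_matrix_vector_assoc matrix_vector_mult_scaleR)
  then show ?thesis by (simp add: bilinear_conv_bounded_bilinear)
qed

lemma (in bounded_bilinear) bounded_prod_tendsto_0:
  fixes f :: "nat \<Rightarrow> 'a" and g :: "nat \<Rightarrow> 'b"
  assumes "bounded (range f)" and "g \<longlonglongrightarrow> 0"
  shows "(\<lambda>k. prod (f k) (g k)) \<longlonglongrightarrow> 0"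
proof -
  have "Bfun f sequentially"
    using assms(1) unfolding Bfun_def bounded_pos by auto
  then show ?thesis
    using Bfun_prod_Zfun assms(2) unfolding tendsto_Zfun_iff by simp
qed

lemma bounded_sum_comp:
  fixes f :: "'i \<Rightarrow> 'a \<Rightarrow> 'b::real_normed_vector"
  assumes "finite I" and "\<And>i. i \<in> I \<Longrightarrow> bounded (f i ` S)"
  shows "bounded ((\<lambda>k. \<Sum>i\<in>I. f i k) ` S)"
  using assms
proof (induction I rule: finite_induct)
  case empty
  show ?case by (auto simp: bounded_iff)
next
  case (insert i I)
  then show ?case by (simp add: bounded_plus_comp)
qed

text \<open>This form separates the gradient at the master point, which the constant and the free option
  share, from a correction with bounded weight that vanishes as \<open>y\<close> approaches \<open>x\<close>. This is
  why \<open>Gamma\<close> has a limit even while the weights \<open>\<omega>\<close> oscillate.\<close>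

lemma Gamma_mult:
  "Gamma g \<omega> x y *v \<mu> =
     (\<Sum>j\<in>UNIV. \<mu> $ j *\<^sub>R (grad_y g j x x + (1 - \<omega> $ j) *\<^sub>R (grad_y g j y x - grad_y g j x x)))"
  unfolding Gamma_def matrix_vector_mult_def vec_eq_iff
  by (auto intro!: sum.cong simp: algebra_simps)

lemma Gamma_mult_tendsto:
  fixes g :: "real^'n \<Rightarrow> real^'n \<Rightarrow> real^'m"
  assumes cont: "\<And>i. continuous_on UNIV (\<lambda>(v, u). grad_y g i v u)"
    and X: "X \<longlonglongrightarrow> l" and Y: "Y \<longlonglongrightarrow> l" and M: "M \<longlonglongrightarrow> m"
    and W: "\<And>k j. 0 \<le> W k $ j \<and> W k $ j \<le> 1"
  shows "(\<lambda>k. Gamma g (W k) (X k) (Y k) *v M k) \<longlonglongrightarrow> (\<Sum>j\<in>UNIV. m $ j *\<^sub>R grad_y g j l l)"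
  unfolding Gamma_mult
proof (rule tendsto_sum)
  fix j
  have grad: "(\<lambda>k. grad_y g j (p k) (X k)) \<longlonglongrightarrow> grad_y g j l l" if "p \<longlonglongrightarrow> l" for p
    using continuous_on_tendsto_compose[OF cont tendsto_Pair[OF that X], of j] by simp
  have "bounded (range (\<lambda>k. 1 - W k $ j))"
    using W unfolding bounded_iff by (intro exI[of _ 1]) auto
  moreover have "(\<lambda>k. grad_y g j (Y k) (X k) - grad_y g j (X k) (X k)) \<longlonglongrightarrow> 0"
    using tendsto_diff[OF grad[OF Y] grad[OF X]] by simp
  ultimately have "(\<lambda>k. (1 - W k $ j) *\<^sub>R (grad_y g j (Y k) (X k) - grad_y g j (X k) (X k))) \<longlonglongrightarrow> 0"
    by (rule bounded_bilinear.bounded_prod_tendsto_0[OF bounded_bilinear_scaleR])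
  from tendsto_scaleR[OF tendsto_vec_nth[OF M] tendsto_add[OF grad[OF X] this]]
  show "(\<lambda>k. M k $ j *\<^sub>R (grad_y g j (X k) (X k) +
      (1 - W k $ j) *\<^sub>R (grad_y g j (Y k) (X k) - grad_y g j (X k) (X k))))
    \<longlonglongrightarrow> m $ j *\<^sub>R grad_y g j l l"
    by simp
qed

lemma zeta_in_F_sub:
  assumes "z \<in> F x"
  shows "zeta g x z \<mu> \<in> F_sub F g a \<omega> Q x z \<mu> x"
proof -
  have "z \<in> F_hat F a x z x"
    using assms by (cases a) (auto simp: F_hat_def)
  moreover have "zeta g x z \<mu> = z + Gamma g \<omega> x x *v \<mu> + Q *v (x - x)"
    by (simp add: zeta_def Gamma_mult)
  ultimately show ?thesis unfolding F_sub_def by blast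
qed

text \<open>Strong monotonicity is applied to the subproblem solution \<open>y\<close> with its value \<open>z\<^sub>s\<close> and to the
  master solution \<open>x\<close> with the value \<open>zeta g x z \<mu>\<close>, the vector that defines the gap; the
  variational inequality at \<open>y\<close>, tested with \<open>x\<close>, disposes of \<open>z\<^sub>s\<close>.\<close>

lemma gap_le_minus_dist_square:
  assumes "monotone_with c (F_sub F g a \<omega> Q x z \<mu>)"
    and VI: "solves_VI (F_sub F g a \<omega> Q x z \<mu>) C y z\<^sub>s"
    and "x \<in> C" and "z \<in> F x"
  shows "gap g x z \<mu> y \<le> - c * (norm (y - x))\<^sup>2"
proof -
  have "z\<^sub>s \<in> F_sub F g a \<omega> Q x z \<mu> y" and "z\<^sub>s \<bullet> (x - y) \<ge> 0"
    using VI \<open>x \<in> C\<close> unfolding solves_VI_def by auto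
  then have "c * (norm (y - x))\<^sup>2 \<le> (z\<^sub>s - zeta g x z \<mu>) \<bullet> (y - x)"
    using monotone_withD[OF assms(1) _ zeta_in_F_sub[of z F x, OF \<open>z \<in> F x\<close>]] by blast
  then show ?thesis
    using \<open>z\<^sub>s \<bullet> (x - y) \<ge> 0\<close> unfolding gap_def by (simp add: inner_diff)
qed

lemma zeta_hat_in_F_hat:
  assumes "z\<^sub>s \<in> F_sub F g a \<omega> Q x z \<mu> y"
  shows "zeta_hat g \<omega> Q x \<mu> y z\<^sub>s \<in> F_hat F a x z y"
  using assms unfolding F_sub_def zeta_hat_def by force

text \<open>This treats the three approximations alike: a value of the approximation at \<open>y\<close> is a genuine
  value of \<open>F\<close>, taken at \<open>x\<close> or at \<open>y\<close>, up to a linear error in \<open>y - x\<close>. Along a subsequence in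
  which the type of approximation keeps changing, one closed graph argument then suffices.\<close>

lemma F_hat_near_value:
  assumes "u \<in> F_hat F a x z y" and "z \<in> F x"
    and "a = First_Order \<Longrightarrow> single_valued_map F"
  shows "\<exists>w p. w \<in> F p \<and> (p = x \<or> p = y) \<and>
    u - w = (if a = First_Order then jacobian (selection F) (at x) else 0) *v (y - x)"
  (is "\<exists>w p. _ \<and> _ \<and> _ = ?J *v _")
proof (cases a)
  case First_Order
  then have "F x = {z}"
    using single_valued_eq_selection[OF assms(3) assms(2)] by metis
  then have "z \<in> F x \<and> (x = x \<or> x = y) \<and> u - z = ?J *v (y - x)"
    using assms(1,2) First_Order by (auto simp: F_hat_def)
  then show ?thesis by blast
next
  case Constant
  then have "z \<in> F x \<and> (x = x \<or> x = y) \<and> u - z = ?J *v (y - x)"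
    using assms(1,2) by (auto simp: F_hat_def)
  then show ?thesis by blast
next
  case Exact
  then have "u \<in> F y \<and> (y = x \<or> y = y) \<and> u - u = ?J *v (y - x)"
    using assms(1) by (auto simp: F_hat_def)
  then show ?thesis by blast
qed

text \<open>By convexity \<open>grad_y g i x x \<bullet> (y - x) \<le> g y x $ i - g x x $ i\<close>, and for feasible \<open>y\<close> the right-hand
  side is at most \<open>- (g x x $ i)\<close>. Complementarity makes the weighted sum nonpositive, so the
  multiplier terms can be dropped from the variational inequality.\<close>

lemma multiplier_elimination:
  assumes g_convex: "\<And>i. convex_on UNIV (\<lambda>v. g v x $ i)"
    and g_differentiable: "\<And>i. (\<lambda>v. g v x $ i) differentiable (at x)"
    and \<mu>: "\<And>i. \<mu> $ i \<ge> 0" "\<And>i. \<mu> $ i * g x x $ i = 0"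
    and "zeta g x z \<mu> \<bullet> (y - x) \<ge> 0" and "y \<in> K_g g x"
  shows "z \<bullet> (y - x) \<ge> 0"
proof -
  have "\<mu> $ i * (grad_y g i x x \<bullet> (y - x)) \<le> 0" for i
  proof -
    have "grad_y g i x x \<bullet> (y - x) \<le> g y x $ i - g x x $ i"
      unfolding grad_y_def
      by (intro convex_gradient_inequality g_convex differentiable_imp_GDERIV_grad g_differentiable)
    also have "\<dots> \<le> - (g x x $ i)"
      using \<open>y \<in> K_g g x\<close> by (simp add: K_g_def less_eq_vec_def)
    finally have "\<mu> $ i * (grad_y g i x x \<bullet> (y - x)) \<le> \<mu> $ i * - (g x x $ i)"
      using \<mu>(1) by (rule mult_left_mono)
    then show ?thesis using \<mu>(2)[of i] by simp
  qed
  then have "(\<Sum>i\<in>UNIV. \<mu> $ i * (grad_y g i x x \<bullet> (y - x))) \<le> 0"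
    by (intro sum_nonpos)
  then show ?thesis
    using assms(5) unfolding zeta_def by (simp add: inner_add_left inner_sum_left)
qed

section \<open>Convergence of the Dantzig-Wolfe algorithm\<close>

theorem theorem4:
  fixes F :: "real^'n \<Rightarrow> (real^'n) set"
    and g :: "real^'n \<Rightarrow> real^'n \<Rightarrow> real^'m"
    and h :: "real^'n \<Rightarrow> real^'l"
    and x y z\<^sub>m z\<^sub>s :: "nat \<Rightarrow> real^'n"
    and \<mu> \<omega> :: "nat \<Rightarrow> real^'m"
    and Q :: "nat \<Rightarrow> real^'n^'n"
    and a :: "nat \<Rightarrow> approx"
    and c :: real
  assumes h_convex: "\<And>i. convex_on UNIV (\<lambda>v. h v $ i)"
    and g_convex: "\<And>i u. convex_on UNIV (\<lambda>v. g v u $ i)"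
    and g_differentiable: "\<And>i u v. (\<lambda>w. g w u $ i) differentiable (at v)"
    and K_h_dom: "K_h h \<subseteq> interior (dom_of F)"
    and y_init: "y 1 \<in> K_g g (y 1) \<inter> K_h h"
    and master: "\<And>k. k \<ge> 1 \<Longrightarrow>
      solves_QVI F (\<lambda>u. K_g g u \<inter> convex hull (y ` {1..k})) (x k) (z\<^sub>m k)"
    and master_KKT: "\<And>k. k \<ge> 1 \<Longrightarrow>
      master_KKT g (convex hull (y ` {1..k})) (x k) (z\<^sub>m k) (\<mu> k)"
    and Q_psd: "\<And>k. k \<ge> 1 \<Longrightarrow> pos_semidef (Q k)"
    and \<omega>_range: "\<And>k j. k \<ge> 1 \<Longrightarrow> 0 \<le> \<omega> k $ j \<and> \<omega> k $ j \<le> 1"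
    and first_order: "\<And>k. k \<ge> 1 \<Longrightarrow> a k = First_Order \<Longrightarrow> single_valued_C1 F"
    and subproblem: "\<And>k. k \<ge> 1 \<Longrightarrow>
      solves_VI (F_sub F g (a k) (\<omega> k) (Q k) (x k) (z\<^sub>m k) (\<mu> k)) (K_h h) (y (k + 1)) (z\<^sub>s (k + 1))"
    and hyp_i: "single_valued_continuous F \<or> maximally_monotone F"
    and hyp_ii: "continuous_on UNIV (\<lambda>(v, u). g v u)"
      "\<And>i. continuous_on UNIV (\<lambda>(v, u). grad_y g i v u)"
    and hyp_iii: "c > 0" "\<And>k. k \<ge> 1 \<Longrightarrow>
      strongly_monotone c (F_sub F g (a k) (\<omega> k) (Q k) (x k) (z\<^sub>m k) (\<mu> k))"
    and hyp_iv: "bounded (Q ` {1..})"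
    and hyp_v: "\<And>k. k \<ge> 1 \<Longrightarrow> gap g (x k) (z\<^sub>m k) (\<mu> k) (y (k + 1)) < 0"
      "bounded (\<mu> ` {1..})"
      "bounded ((\<lambda>k. y (k + 1)) ` {1..})"
  shows "(\<lambda>k. gap g (x k) (z\<^sub>m k) (\<mu> k) (y (k + 1))) \<longlonglongrightarrow> 0 \<and>
    (\<lambda>k. norm (y (k + 1) - x k)) \<longlonglongrightarrow> 0 \<and>
    (\<forall>xbar zetabar.
      accumulation_point
        (\<lambda>k. (x k, zeta_hat g (\<omega> k) (Q k) (x k) (\<mu> k) (y (k + 1)) (z\<^sub>s (k + 1))))
        (xbar, zetabar) \<longrightarrow>
      solves_QVI F (\<lambda>u. K_g g u \<inter> K_h h) xbar zetabar)"
proof -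
  \<comment> \<open>A compact subset of the interior of the domain that contains all master solutions.\<close>
  define C where "C = closure (convex hull (y ` {1..}))"
  have y_bounded: "bounded (y ` {1..})"
  proof -
    have "y ` {1..} \<subseteq> insert (y 1) ((\<lambda>k. y (k + 1)) ` {1..})"
    proof
      fix v assume "v \<in> y ` {1..}"
      then obtain k where k: "k \<ge> 1" "v = y k" by auto
      then show "v \<in> insert (y 1) ((\<lambda>k. y (k + 1)) ` {1..})"
        by (cases "k = 1") (auto intro!: image_eqI[of _ _ "k - 1"])
    qed
    then show ?thesis
      using hyp_v(3) bounded_subset bounded_insert by metis
  qed
  then have "compact C"
    unfolding C_def by (simp add: bounded_convex_hull compact_closure)
  have y_in: "y k \<in> K_h h" if "k \<ge> 1" for k
    using y_init subproblem[of "k - 1"] that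
    by (cases "k = 1") (auto simp: solves_VI_def)
  have K_h_closed: "closed (K_h h)" using closed_K_h h_convex by blast
  have "C \<subseteq> K_h h"
    unfolding C_def
    by (intro closure_minimal hull_minimal K_h_closed convex_K_h h_convex) (use y_in in auto)
  then have C_dom: "C \<subseteq> interior (dom_of F)" using K_h_dom by blast
  have x_hull: "x k \<in> convex hull (y ` {1..k})" and z_in: "z\<^sub>m k \<in> F (x k)" if "k \<ge> 1" for k
    using master[OF that] unfolding solves_QVI_def by auto
  have x_in: "x k \<in> C" if "k \<ge> 1" for k
  proof -
    have "convex hull (y ` {1..k}) \<subseteq> C"
      unfolding C_def by (rule order_trans[OF hull_mono closure_subset]) auto
    then show ?thesis using x_hull[OF that] by blast
  qed

  define \<zeta> where "\<zeta> k = zeta g (x k) (z\<^sub>m k) (\<mu> k)" for k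
  have gap_eq: "gap g (x k) (z\<^sub>m k) (\<mu> k) (y (k + 1)) = \<zeta> k \<bullet> (y (k + 1) - x k)" for k
    by (simp add: gap_def \<zeta>_def)

  have "bounded (\<zeta> ` {1..})"
  proof -
    have "bounded (\<Union>x\<in>C. F x)"
      using hyp_i
    proof
      assume "single_valued_continuous F"
      then show ?thesis
        using single_valued_continuous_bounded_on_compact \<open>compact C\<close> C_dom interior_subset
        by (metis subset_trans)
    next
      assume "maximally_monotone F"
      then show ?thesis
        using monotone_map_bounded_on_compact \<open>compact C\<close> C_dom
        unfolding maximally_monotone_def by blast
    qed
    moreover have "z\<^sub>m ` {1..} \<subseteq> (\<Union>x\<in>C. F x)"
      using x_in z_in by auto
    ultimately have "bounded (z\<^sub>m ` {1..})" by (rule bounded_subset)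
    moreover have "bounded ((\<lambda>k. \<mu> k $ i *\<^sub>R grad_y g i (x k) (x k)) ` {1..})" for i
    proof -
      have "continuous_on C (\<lambda>v. grad_y g i v v)"
        using continuous_on_compose2[OF hyp_ii(2), of C "\<lambda>v. (v, v)" i]
        by (simp add: continuous_on_Pair continuous_on_id)
      then have "bounded ((\<lambda>v. grad_y g i v v) ` C)"
        using \<open>compact C\<close> compact_continuous_image compact_imp_bounded by blast
      then obtain G where G: "\<And>v. v \<in> C \<Longrightarrow> norm (grad_y g i v v) \<le> G"
        unfolding bounded_iff by auto
      obtain M where M: "\<And>k. k \<ge> 1 \<Longrightarrow> norm (\<mu> k) \<le> M"
        using hyp_v(2) unfolding bounded_iff by auto
      have "norm (\<mu> k $ i *\<^sub>R grad_y g i (x k) (x k)) \<le> M * G" if "k \<ge> 1" for k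
      proof -
        have "\<bar>\<mu> k $ i\<bar> \<le> M"
          using component_le_norm_cart M[OF that] by (rule order_trans)
        then have "\<bar>\<mu> k $ i\<bar> * norm (grad_y g i (x k) (x k)) \<le> M * G"
          using G[OF x_in[OF that]] by (intro mult_mono) auto
        then show ?thesis by simp
      qed
      then show ?thesis unfolding bounded_iff by auto
    qed
    then have "bounded ((\<lambda>k. \<Sum>i\<in>UNIV. \<mu> k $ i *\<^sub>R grad_y g i (x k) (x k)) ` {1..})"
      by (intro bounded_sum_comp) auto
    ultimately show ?thesis
      unfolding \<zeta>_def zeta_def by (rule bounded_plus_comp)
  qed
  moreover have "\<zeta> k \<bullet> (y j - x k) \<ge> 0" if "1 \<le> j" "j \<le> k" for j k
  proof -
    have "- \<zeta> k \<in> normal_cone (convex hull (y ` {1..k})) (x k)"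
      using master_KKT[of k] that unfolding master_KKT_def \<zeta>_def
      by (metis (no_types, lifting) add_eq_0_iff imageE order_trans)
    moreover have "y j \<in> convex hull (y ` {1..k})"
      using that by (intro hull_inc) auto
    ultimately show ?thesis unfolding normal_cone_def by force
  qed
  moreover have "\<zeta> k \<bullet> (y (k + 1) - x k) \<le> 0" if "k \<ge> 1" for k
    using hyp_v(1)[OF that] unfolding gap_eq by (rule less_imp_le)
  ultimately have gap_lim: "(\<lambda>k. gap g (x k) (z\<^sub>m k) (\<mu> k) (y (k + 1))) \<longlonglongrightarrow> 0"
    unfolding gap_eq using cutting_plane_gap_tendsto_0 hyp_v(3) by blast

  have dist_lim: "(\<lambda>k. norm (y (k + 1) - x k)) \<longlonglongrightarrow> 0"
  proof (rule tendsto_0_if_square_le[OF gap_lim \<open>c > 0\<close>])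
    show "gap g (x k) (z\<^sub>m k) (\<mu> k) (y (k + 1)) \<le> - c * (norm (y (k + 1) - x k))\<^sup>2" if "k \<ge> 1" for k
      using hyp_iii(2)[OF that] x_in[OF that] \<open>C \<subseteq> K_h h\<close> z_in[OF that]
      unfolding strongly_monotone_def
      by (intro gap_le_minus_dist_square[OF _ subproblem[OF that]]) auto
  qed

  have "solves_QVI F (\<lambda>u. K_g g u \<inter> K_h h) xbar zetabar"
    if acc: "accumulation_point
        (\<lambda>k. (x k, zeta_hat g (\<omega> k) (Q k) (x k) (\<mu> k) (y (k + 1)) (z\<^sub>s (k + 1)))) (xbar, zetabar)"
    for xbar zetabar
  proof -
    \<comment> \<open>The sequences carry information from index 1 on only, so the subsequence starts at
      \<open>Suc\<close>; it is then refined once more so that the multipliers converge.\<close>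
    define \<zeta>' where "\<zeta>' k = zeta_hat g (\<omega> k) (Q k) (x k) (\<mu> k) (y (k + 1)) (z\<^sub>s (k + 1))" for k
    obtain r where r: "strict_mono r" and r_lim: "(\<lambda>i. (x (r i), \<zeta>' (r i))) \<longlonglongrightarrow> (xbar, zetabar)"
      using acc unfolding accumulation_point_def \<zeta>'_def by (auto simp: o_def)
    have r_Suc: "r (Suc i) \<ge> 1" for i
      using seq_suble[OF r, of "Suc i"] by simp
    have "bounded (range (\<lambda>i. \<mu> (r (Suc i))))"
      using hyp_v(2) by (rule bounded_subset) (use r_Suc in auto)
    then obtain mbar q where q: "strict_mono q" and "((\<lambda>i. \<mu> (r (Suc i))) \<circ> q) \<longlonglongrightarrow> mbar"
      using bounded_imp_convergent_subsequence by blast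
    define s where "s i = r (Suc (q i))" for i
    have s: "strict_mono s"
      using r q unfolding s_def strict_mono_def by simp
    have s1: "s i \<ge> 1" for i using r_Suc unfolding s_def .
    have \<mu>_lim: "(\<lambda>i. \<mu> (s i)) \<longlonglongrightarrow> mbar"
      using \<open>(_ \<circ> q) \<longlonglongrightarrow> mbar\<close> by (simp add: s_def o_def)
    have pair_lim: "(\<lambda>i. (x (s i), \<zeta>' (s i))) \<longlonglongrightarrow> (xbar, zetabar)"
    proof -
      have "strict_mono (\<lambda>i. Suc (q i))" using q unfolding strict_mono_def by simp
      from LIMSEQ_subseq_LIMSEQ[OF r_lim this] show ?thesis by (simp add: o_def s_def)
    qed
    have x_lim: "(\<lambda>i. x (s i)) \<longlonglongrightarrow> xbar" and \<zeta>'_lim: "(\<lambda>i. \<zeta>' (s i)) \<longlonglongrightarrow> zetabar"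
      using tendsto_fst[OF pair_lim] tendsto_snd[OF pair_lim] by simp_all
    have diff_lim: "(\<lambda>i. y (s i + 1) - x (s i)) \<longlonglongrightarrow> 0"
      using LIMSEQ_subseq_LIMSEQ[OF dist_lim s] by (simp add: o_def tendsto_norm_zero_iff)
    have y_lim: "(\<lambda>i. y (s i + 1)) \<longlonglongrightarrow> xbar"
      using tendsto_add[OF x_lim diff_lim] by simp

    have "xbar \<in> C"
      using closed_sequentially[OF compact_imp_closed[OF \<open>compact C\<close>] x_in[OF s1] x_lim] .
    then have xbar_K_h: "xbar \<in> K_h h" and xbar_dom: "xbar \<in> dom_of F"
      using \<open>C \<subseteq> K_h h\<close> C_dom interior_subset by blast+

    have g_lim: "(\<lambda>i. g (x (s i)) (x (s i))) \<longlonglongrightarrow> g xbar xbar"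
      using continuous_on_tendsto_compose[OF hyp_ii(1) tendsto_Pair[OF x_lim x_lim]] by simp
    have KKT: "\<mu> (s i) $ j \<ge> 0" "g (x (s i)) (x (s i)) $ j \<le> 0"
      "\<mu> (s i) $ j * g (x (s i)) (x (s i)) $ j = 0" for i j
      using master_KKT[OF s1] unfolding master_KKT_def by auto
    have xbar_K_g: "xbar \<in> K_g g xbar"
      unfolding K_g_def less_eq_vec_def
      using LIMSEQ_le_const2[OF tendsto_vec_nth[OF g_lim]] KKT(2) by auto
    have mbar_nonneg: "mbar $ j \<ge> 0" for j
      using LIMSEQ_le_const[OF tendsto_vec_nth[OF \<mu>_lim]] KKT(1) by auto
    have mbar_compl: "mbar $ j * g xbar xbar $ j = 0" for j
    proof -
      have "(\<lambda>i. \<mu> (s i) $ j * g (x (s i)) (x (s i)) $ j) \<longlonglongrightarrow> mbar $ j * g xbar xbar $ j"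
        by (intro tendsto_mult tendsto_vec_nth \<mu>_lim g_lim)
      then show ?thesis unfolding KKT(3) by (simp add: LIMSEQ_const_iff)
    qed

    have in_F: "zetabar \<in> F xbar"
    proof -
      define J where "J k = (if a k = First_Order then jacobian (selection F) (at (x k)) else 0)" for k
      have "\<exists>w p. w \<in> F p \<and> (p = x (s i) \<or> p = y (s i + 1)) \<and>
          \<zeta>' (s i) - w = J (s i) *v (y (s i + 1) - x (s i))" for i
      proof -
        have "\<zeta>' (s i) \<in> F_hat F (a (s i)) (x (s i)) (z\<^sub>m (s i)) (y (s i + 1))"
          unfolding \<zeta>'_def by (rule zeta_hat_in_F_hat) (use subproblem[OF s1] in \<open>auto simp: solves_VI_def\<close>)
        moreover have "z\<^sub>m (s i) \<in> F (x (s i))" by (rule z_in[OF s1])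
        moreover have "single_valued_map F" if "a (s i) = First_Order"
          using first_order[OF s1 that] unfolding single_valued_C1_def by blast
        ultimately show ?thesis
          unfolding J_def by (rule F_hat_near_value)
      qed
      then obtain w p where w: "\<And>i. w i \<in> F (p i)"
        and p: "\<And>i. p i = x (s i) \<or> p i = y (s i + 1)"
        and \<zeta>'_w: "\<And>i. \<zeta>' (s i) - w i = J (s i) *v (y (s i + 1) - x (s i))"
        by metis
      have "bounded (range (\<lambda>i. J (s i)))"
      proof (cases "\<exists>k\<ge>1. a k = First_Order")
        case True
        then have "continuous_on C (\<lambda>v. jacobian (selection F) (at v))"
          using first_order C_dom continuous_on_subset unfolding single_valued_C1_def by blast
        then have "bounded (insert 0 ((\<lambda>v. jacobian (selection F) (at v)) ` C))"
          using \<open>compact C\<close> compact_continuous_image compact_imp_bounded by auto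
        then show ?thesis
          by (rule bounded_subset) (use x_in[OF s1] in \<open>auto simp: J_def\<close>)
      next
        case False
        then have "J (s i) = 0" for i using s1 by (auto simp: J_def)
        then show ?thesis by (auto simp: bounded_iff)
      qed
      then have "(\<lambda>i. \<zeta>' (s i) - w i) \<longlonglongrightarrow> 0"
        unfolding \<zeta>'_w
        by (rule bounded_bilinear.bounded_prod_tendsto_0[OF bounded_bilinear_matrix_vector_mult])
          (rule diff_lim)
      from tendsto_diff[OF \<zeta>'_lim this] have w_lim: "w \<longlonglongrightarrow> zetabar" by simp
      have p_lim: "p \<longlonglongrightarrow> xbar"
      proof -
        have "norm (p i - x (s i)) \<le> norm (y (s i + 1) - x (s i))" for i
          using p[of i] by auto
        then have "(\<lambda>i. p i - x (s i)) \<longlonglongrightarrow> 0"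
          by (intro Lim_null_comparison[OF always_eventually tendsto_norm_zero[OF diff_lim]] allI)
        from tendsto_add[OF this x_lim] show ?thesis by simp
      qed
      show ?thesis
        using hyp_i maximally_monotone_closed_graph[OF _ w p_lim w_lim]
          single_valued_continuous_closed_graph[OF _ xbar_dom w p_lim w_lim] by blast
    qed

    \<comment> \<open>The limit of the subproblem inequalities: the perturbation by \<open>Q\<close> vanishes, and the
      \<open>Gamma\<close> term becomes the multiplier term of the Lagrangian at the limit.\<close>
    have VI_lim: "zeta g xbar zetabar mbar \<bullet> (v - xbar) \<ge> 0" if "v \<in> K_h h" for v
    proof -
      have "bounded (range (\<lambda>i. Q (s i)))"
        using hyp_iv by (rule bounded_subset) (use s1 in auto)
      then have Q_lim: "(\<lambda>i. Q (s i) *v (y (s i + 1) - x (s i))) \<longlonglongrightarrow> 0"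
        by (rule bounded_bilinear.bounded_prod_tendsto_0[OF bounded_bilinear_matrix_vector_mult])
          (rule diff_lim)
      have "(\<lambda>i. \<zeta>' (s i) + Gamma g (\<omega> (s i)) (x (s i)) (y (s i + 1)) *v \<mu> (s i)
          + Q (s i) *v (y (s i + 1) - x (s i))) \<longlonglongrightarrow> zeta g xbar zetabar mbar"
        unfolding zeta_def
        using tendsto_add[OF tendsto_add[OF \<zeta>'_lim
            Gamma_mult_tendsto[OF hyp_ii(2) x_lim y_lim \<mu>_lim \<omega>_range[OF s1]]] Q_lim]
        by simp
      then have "(\<lambda>i. z\<^sub>s (s i + 1)) \<longlonglongrightarrow> zeta g xbar zetabar mbar"
        by (simp add: \<zeta>'_def zeta_hat_def)
      then have "(\<lambda>i. z\<^sub>s (s i + 1) \<bullet> (v - y (s i + 1))) \<longlonglongrightarrow> zeta g xbar zetabar mbar \<bullet> (v - xbar)"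
        by (intro tendsto_intros y_lim)
      moreover have "z\<^sub>s (s i + 1) \<bullet> (v - y (s i + 1)) \<ge> 0" for i
        using subproblem[OF s1] that unfolding solves_VI_def by blast
      ultimately show ?thesis
        by (intro LIMSEQ_le_const) auto
    qed

    have "zetabar \<bullet> (v - xbar) \<ge> 0" if "v \<in> K_g g xbar \<inter> K_h h" for v
      using multiplier_elimination[OF g_convex g_differentiable mbar_nonneg mbar_compl VI_lim] that
      by blast
    then show ?thesis
      unfolding solves_QVI_def using xbar_K_g xbar_K_h in_F by blast
  qed
  then show ?thesis using gap_lim dist_lim by blast
qed

end
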